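(* For each integer $k\geq 2$, the complement $\overline{And(k)}$ of the Andrásfai graph $And(k)$ satisfies $\dim_M(\overline{And(k)})=k$.
   Context: All graphs are finite, simple and undirected. For a connected graph $G$, $d(x,y)$ denotes the length of a shortest path between vertices $x$ and $y$. A set $W\subseteq V(G)$ is a resolving set for $G$ if for each pair of distinct vertices $u,v\in V(G)$ there exists $t\in W$ with $d(u,t)\neq d(v,t)$. The metric dimension $\dim_M(G)$ is the minimum cardinality of a resolving set for $G$. $\overline{G}$ denotes the complement graph of $G$. For an integer $k\geq 1$, the Andrásfai graph $And(k)$ is the Cayley graph $Cay(\mathbb{Z}_{3k-1},S)$ of the additive group of integers modulo $3k-1$ with $S=\{1,4,7,\ldots,3k-2\}$ (the classes of the integers in $\{1,\ldots,3k-1\}$ congruent to $1$ modulo $3$; $S=-S$ and $0\notin S$). That is, its vertex set is $\mathbb{Z}_{3k-1}$ and two vertices $u,v$ are adjacent if and only if $u-v\in S$. For $k\ge 2$ the graph $\overline{And(k)}$ is connected. *)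

theory Defs
  imports "Graph_Theory.Graph_Theory" "HOL-Algebra.Elementary_Groups"
begin

text \<open>
  Finite simple graphs are finite symmetric loopless digraphs whose arcs are pairs of vertices
  (locale \<^locale>\<open>pair_graph\<close>): every edge is represented by its two orientations.
\<close>

definition cayley_graph :: "('a, 'm) monoid_scheme \<Rightarrow> 'a set \<Rightarrow> 'a pair_pre_digraph" where
  "cayley_graph \<Gamma> S =
    \<lparr> pverts = carrier \<Gamma>,
      parcs = {(u, v). u \<in> carrier \<Gamma> \<and> v \<in> carrier \<Gamma> \<and> u \<otimes>\<^bsub>\<Gamma>\<^esub> inv\<^bsub>\<Gamma>\<^esub> v \<in> S} \<rparr>"

text \<open>
  For \<open>n > 0\<close>, \<^term>\<open>integer_mod_group n\<close> is \<open>{0..<n}\<close> with addition modulo \<open>n\<close> (for \<open>n = 0\<close> it is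
  the additive group of all integers). The truncated subtraction is exact for \<open>k \<ge> 1\<close>. The
  connection set is \<open>{1, 4, 7, \<dots>, 3k - 2}\<close>, which already consists of representatives in
  \<open>{0..<3k - 1}\<close>.
\<close>

definition andrasfai :: "nat \<Rightarrow> int pair_pre_digraph" where
  "andrasfai k =
    cayley_graph (integer_mod_group (3 * k - 1)) {s. 1 \<le> s \<and> s \<le> 3 * int k - 1 \<and> s mod 3 = 1}"

definition complement_graph :: "'a pair_pre_digraph \<Rightarrow> 'a pair_pre_digraph" where
  "complement_graph G =
    \<lparr> pverts = pverts G,
      parcs = {(u, v). u \<in> pverts G \<and> v \<in> pverts G \<and> u \<noteq> v \<and> (u, v) \<notin> parcs G} \<rparr>"

text \<open>
  Distance is the shortest-path cost of the library with every arc of cost 1. It is \<open>\<infinity>\<close> when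
  there is no path; the lemma \<open>graph_dist_shortest_path\<close> below gives the characterization in
  terms of paths.
\<close>

definition graph_dist :: "('a, 'b) pre_digraph \<Rightarrow> 'a \<Rightarrow> 'a \<Rightarrow> ereal" where
  "graph_dist G u v = wf_digraph.\<mu> G (\<lambda>_. 1) u v"

definition resolving_set :: "('a, 'b) pre_digraph \<Rightarrow> 'a set \<Rightarrow> bool" where
  "resolving_set G W \<longleftrightarrow> W \<subseteq> verts G \<and>
    (\<forall>u \<in> verts G. \<forall>v \<in> verts G. u \<noteq> v \<longrightarrow> (\<exists>t \<in> W. graph_dist G u t \<noteq> graph_dist G v t))"

text \<open>Intended for finite graphs, where the minimum is attained (\<open>metric_dim_attained\<close> below).\<close>

definition metric_dim :: "('a, 'b) pre_digraph \<Rightarrow> nat" where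
  "metric_dim G = (LEAST n. \<exists>W. resolving_set G W \<and> card W = n)"


lemma (in wf_digraph) awalk_cost_one: "awalk_cost (\<lambda>_. 1) p = real (length p)"
  by (induct p) auto

lemma (in fin_digraph) graph_dist_shortest_path:
  assumes "u \<rightarrow>\<^sup>* v"
  shows "\<exists>p. apath u p v \<and> graph_dist G u v = ereal (real (length p)) \<and>
    (\<forall>q. apath u q v \<longrightarrow> length p \<le> length q)"
proof -
  obtain p where p: "apath u p v" "\<mu> (\<lambda>_. 1) u v = awalk_cost (\<lambda>_. 1) p"
    using min_cost_awalk[OF assms, of "\<lambda>_. 1"] by auto
  have "length p \<le> length q" if "apath u q v" for q
  proof -
    have "\<mu> (\<lambda>_. 1) u v \<le> awalk_cost (\<lambda>_. 1) q"
      using that by (intro min_cost_le_walk_cost) (auto simp: apath_def)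
    with p show ?thesis by (simp add: awalk_cost_one)
  qed
  with p show ?thesis by (auto simp: graph_dist_def awalk_cost_one)
qed

lemma (in fin_digraph) graph_dist_eq_0_iff:
  assumes "u \<in> verts G"
  shows "graph_dist G u v = 0 \<longleftrightarrow> u = v"
proof
  assume *: "graph_dist G u v = 0"
  then have "u \<rightarrow>\<^sup>* v" using \<mu>_reach_conv[of "\<lambda>_. 1" u v] by (simp add: graph_dist_def)
  from graph_dist_shortest_path[OF this] obtain p
    where "apath u p v" "graph_dist G u v = ereal (real (length p))" by blast
  with * show "u = v" by (auto simp: apath_def awalk_Nil_iff)
next
  assume "u = v"
  moreover have "apath u [] u" using assms by (simp add: apath_Nil_iff)
  moreover have "u \<rightarrow>\<^sup>* u" using assms by simp
  ultimately show "graph_dist G u v = 0"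
    using graph_dist_shortest_path[of u v] by (metis le_zero_eq list.size(3) of_nat_0 zero_ereal_def)
qed

lemma (in fin_digraph) resolving_set_verts: "resolving_set G (verts G)"
  unfolding resolving_set_def by (metis graph_dist_eq_0_iff subset_refl)

lemma (in fin_digraph) metric_dim_attained:
  "\<exists>W. resolving_set G W \<and> finite W \<and> card W = metric_dim G"
proof -
  have "\<exists>W. resolving_set G W \<and> card W = metric_dim G"
    unfolding metric_dim_def by (rule LeastI_ex) (use resolving_set_verts in blast)
  then show ?thesis using finite_subset[OF _ finite_verts] by (auto simp: resolving_set_def)
qed

lemma (in fin_digraph) metric_dim_le: "resolving_set G W \<Longrightarrow> metric_dim G \<le> card W"
  unfolding metric_dim_def by (rule Least_le) blast

lemma pverts_andrasfai: "k \<ge> 1 \<Longrightarrow> pverts (andrasfai k) = {0..<3 * int k - 1}"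
  by (simp add: andrasfai_def cayley_graph_def carrier_integer_mod_group of_nat_diff)

lemma parcs_andrasfai:
  assumes "k \<ge> 1"
  shows "(u, v) \<in> parcs (andrasfai k) \<longleftrightarrow> u \<in> {0..<3 * int k - 1} \<and> v \<in> {0..<3 * int k - 1} \<and>
    ((u - v) mod (3 * int k - 1)) mod 3 = 1"
proof -
  have *: "int (3 * k - 1) = 3 * int k - 1" "3 * k - 1 \<noteq> 0" using assms by auto
  have "(u - v) mod (3 * int k - 1) \<ge> 1 \<and> (u - v) mod (3 * int k - 1) \<le> 3 * int k - 1"
    if "((u - v) mod (3 * int k - 1)) mod 3 = 1"
  proof -
    have "0 \<le> (u - v) mod (3 * int k - 1)" "(u - v) mod (3 * int k - 1) < 3 * int k - 1"
      using assms by auto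
    moreover have "(u - v) mod (3 * int k - 1) \<noteq> 0" using that by auto
    ultimately show ?thesis by linarith
  qed
  then show ?thesis
    using * by (auto simp: andrasfai_def cayley_graph_def carrier_integer_mod_group mod_add_right_eq)
qed

lemma pair_graph_andrasfai:
  assumes "k \<ge> 1"
  shows "pair_graph (andrasfai k)"
proof -
  let ?n = "3 * int k - 1"
  have sub: "parcs (andrasfai k) \<subseteq> {0..<?n} \<times> {0..<?n}"
    using parcs_andrasfai[OF assms] by auto
  have sym: "(v, u) \<in> parcs (andrasfai k)" if "(u, v) \<in> parcs (andrasfai k)" for u v
  proof -
    from that have a: "u \<in> {0..<?n}" "v \<in> {0..<?n}" "((u - v) mod ?n) mod 3 = 1"
      using parcs_andrasfai[OF assms] by auto
    then have "(u - v) mod ?n \<noteq> 0" by auto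
    then have "(v - u) mod ?n = ?n - (u - v) mod ?n"
      using zmod_zminus1_eq_if[of "u - v" ?n] by simp
    moreover have "(?n - (u - v) mod ?n) mod 3 = 1"
    proof -
      have "(3 * j - 1 - m) mod 3 = 1" if "m mod 3 = 1" for j m :: int
        using that by presburger
      then show ?thesis using a(3) by blast
    qed
    ultimately show ?thesis using a parcs_andrasfai[OF assms] by auto
  qed
  show ?thesis
    using sub sym finite_subset[OF sub] parcs_andrasfai[OF assms]
    by unfold_locales (auto simp: pverts_andrasfai[OF assms] symmetric_def sym_def)
qed

lemma pair_graph_complement:
  assumes "pair_graph G"
  shows "pair_graph (complement_graph G)"
proof -
  interpret pair_graph G by fact
  have "finite (parcs (complement_graph G))"
    by (rule finite_subset[of _ "pverts G \<times> pverts G"]) (auto simp: complement_graph_def)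
  moreover have "(u, v) \<in> parcs G \<Longrightarrow> (v, u) \<in> parcs G" for u v
    using pair_sym_arcs by (auto simp: symmetric_def sym_def)
  ultimately show ?thesis
    by unfold_locales (auto simp: complement_graph_def symmetric_def sym_def)
qed

end

theory Submission
  imports Defs
begin

text \<open>
  Write \<open>n = 3k - 1\<close>. In the complement of \<open>And(k)\<close> two distinct vertices are at distance 1 or 2,
  according to whether they are non-adjacent or adjacent in \<open>And(k)\<close>. Hence a set \<open>W\<close> is resolving
  iff any two vertices outside \<open>W\<close> have different sets of \<open>And(k)\<close>-neighbours in \<open>W\<close>
  (\<open>resolving_complement_andrasfai_iff\<close>).

  For the upper bound take \<open>W = {0, 3, \<dots>, 3k - 3}\<close>. A vertex \<open>x\<close> of residue 1 modulo 3 is adjacent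
  to exactly the elements of \<open>W\<close> below \<open>x\<close>, one of residue 2 to exactly those above \<open>x\<close>. These
  initial and final segments are pairwise different.

  For the lower bound, multiplication by \<open>k\<close>, the inverse of \<open>3\<close> modulo \<open>n\<close>, carries the connection
  set to the interval \<open>{k, \<dots>, 2k - 1}\<close>. In the new coordinate the neighbourhood of a vertex is
  therefore an arc of the cycle, and while the coordinate runs from \<open>0\<close> to \<open>n - 1\<close>, adjacency to a
  fixed \<open>t\<close> changes at most twice (\<open>adjacency_thresholds\<close>). So the traces on \<open>W\<close> change at most
  \<open>2 |W|\<close> times along the whole range, which leaves room for at most \<open>2 |W| + 1\<close> vertices outside
  \<open>W\<close>. From \<open>n \<le> 3 |W| + 1\<close> it follows that \<open>k \<le> |W|\<close>.
\<close>

section \<open>Resolving sets in graphs of diameter two\<close>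

lemma (in pair_fin_digraph) graph_dist_eq_1:
  assumes "(u, v) \<in> parcs G" "u \<noteq> v"
  shows "graph_dist G u v = 1"
proof -
  have V: "u \<in> pverts G" "v \<in> pverts G" using assms by (auto dest: arc_fst_in_verts arc_snd_in_verts)
  have p: "apath u [(u, v)] v"
    using assms V by (auto simp: apath_def awalk_simps)
  then have "u \<rightarrow>\<^sup>*\<^bsub>with_proj G\<^esub> v" using reachable_awalk by (auto simp: apath_def)
  from graph_dist_shortest_path[OF this] obtain q where q: "apath u q v"
    "graph_dist G u v = ereal (real (length q))" "length q \<le> 1"
    using p by (metis One_nat_def length_Cons list.size(3))
  moreover have "q \<noteq> []" using q(1) assms(2) by (auto simp: apath_def awalk_Nil_iff)
  ultimately have "length q = 1" by (cases q) auto
  with q show ?thesis by (simp add: one_ereal_def)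
qed

lemma (in pair_fin_digraph) graph_dist_eq_2:
  assumes "(u, w) \<in> parcs G" "(w, v) \<in> parcs G" "u \<noteq> v" "(u, v) \<notin> parcs G"
  shows "graph_dist G u v = 2"
proof -
  have V: "u \<in> pverts G" "v \<in> pverts G" "w \<in> pverts G"
    using assms by (auto dest: arc_fst_in_verts arc_snd_in_verts)
  have d: "u \<noteq> w" "w \<noteq> v" using assms by auto
  have p: "apath u [(u, w), (w, v)] v"
    using assms V d by (auto simp: apath_def awalk_simps)
  then have "u \<rightarrow>\<^sup>*\<^bsub>with_proj G\<^esub> v" using reachable_awalk by (auto simp: apath_def)
  from graph_dist_shortest_path[OF this] obtain q where q: "apath u q v"
    "graph_dist G u v = ereal (real (length q))" "length q \<le> length [(u, w), (w, v)]"
    using p by blast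
  moreover have "q \<noteq> []" using q(1) assms(3) by (auto simp: apath_def awalk_Nil_iff)
  moreover have "q \<noteq> [e]" for e
    using q(1) assms(4) by (cases e) (auto simp: apath_def awalk_simps)
  ultimately have "length q = 2"
    by (cases q; cases "tl q") auto
  with q show ?thesis by simp
qed

text \<open>
  With only the distances 0, 1 and 2 available, a landmark \<open>t\<close> separates two other vertices iff it is
  adjacent to exactly one of them; and a landmark separates itself from every other vertex.
\<close>

lemma (in pair_graph) resolving_set_diameter_two:
  assumes two: "\<And>u v. u \<in> pverts G \<Longrightarrow> v \<in> pverts G \<Longrightarrow> u \<noteq> v \<Longrightarrow> (u, v) \<notin> parcs G \<Longrightarrow>
      \<exists>w. (u, w) \<in> parcs G \<and> (w, v) \<in> parcs G"
  shows "resolving_set G W \<longleftrightarrow> W \<subseteq> pverts G \<and>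
    (\<forall>u \<in> pverts G - W. \<forall>v \<in> pverts G - W. u \<noteq> v \<longrightarrow>
      (\<exists>t \<in> W. (u, t) \<in> parcs G \<longleftrightarrow> (v, t) \<notin> parcs G))"
proof -
  have dist: "graph_dist G u v = (if u = v then 0 else if (u, v) \<in> parcs G then 1 else 2)"
    if "u \<in> pverts G" "v \<in> pverts G" for u v
    using that two[of u v] graph_dist_eq_0_iff[of u v] graph_dist_eq_1[of u v]
      graph_dist_eq_2[of u _ v] by auto
  have sep: "graph_dist G u t \<noteq> graph_dist G v t \<longleftrightarrow>
      (if t = u \<or> t = v then u \<noteq> v else (u, t) \<in> parcs G \<longleftrightarrow> (v, t) \<notin> parcs G)"
    if "u \<in> pverts G" "v \<in> pverts G" "t \<in> pverts G" for u v t
    using that by (auto simp: dist)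
  show ?thesis
  proof (cases "W \<subseteq> pverts G")
    case True
    have "(\<exists>t \<in> W. graph_dist G u t \<noteq> graph_dist G v t) \<longleftrightarrow>
        u \<in> W \<or> v \<in> W \<or> (\<exists>t \<in> W. (u, t) \<in> parcs G \<longleftrightarrow> (v, t) \<notin> parcs G)"
      if uv: "u \<in> pverts G" "v \<in> pverts G" "u \<noteq> v" for u v
    proof (cases "u \<in> W \<or> v \<in> W")
      case True
      then show ?thesis
        using sep[OF uv(1,2), of u] sep[OF uv(1,2), of v] uv by auto
    next
      case False
      have "(graph_dist G u t \<noteq> graph_dist G v t) =
          ((u, t) \<in> parcs G \<longleftrightarrow> (v, t) \<notin> parcs G)" if "t \<in> W" for t
      proof -
        have "t \<in> pverts G" "t \<noteq> u" "t \<noteq> v" using that False \<open>W \<subseteq> pverts G\<close> by auto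
        then show ?thesis using sep[OF uv(1,2), of t] by simp
      qed
      then show ?thesis using False by blast
    qed
    with True show ?thesis unfolding resolving_set_def with_proj_simps by blast
  next
    case False
    then show ?thesis by (auto simp: resolving_set_def)
  qed
qed

section \<open>The complement of the Andrasfai graph\<close>

abbreviation adj :: "nat \<Rightarrow> int \<Rightarrow> int \<Rightarrow> bool" where
  "adj k u v \<equiv> (u, v) \<in> parcs (andrasfai k)"

text \<open>
  Passing from \<open>u - v < 0\<close> to its representative \<open>u - v + 3k - 1\<close> lowers the residue modulo 3 by
  one, so below \<open>v\<close> the residue that signals adjacency is 2 instead of 1.
\<close>

lemma adj_iff:
  assumes "k \<ge> 1" "u \<in> {0..<3 * int k - 1}" "v \<in> {0..<3 * int k - 1}"
  shows "adj k u v \<longleftrightarrow> (if v \<le> u then (u - v) mod 3 = 1 else (u - v) mod 3 = 2)"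
proof (cases "v \<le> u")
  case True
  then have "(u - v) mod (3 * int k - 1) = u - v" using assms by auto
  then show ?thesis using True assms by (simp add: parcs_andrasfai)
next
  case False
  have "(u - v) mod (3 * int k - 1) = (u - v + (3 * int k - 1)) mod (3 * int k - 1)" by simp
  also have "\<dots> = u - v + (3 * int k - 1)" using False assms by (intro mod_pos_pos_trivial) auto
  finally have e: "(u - v) mod (3 * int k - 1) = u - v + (3 * int k - 1)" .
  have "(u - v + (3 * int k - 1)) mod 3 = 1 \<longleftrightarrow> (u - v) mod 3 = 2" by presburger
  then show ?thesis using False assms e by (simp add: parcs_andrasfai)
qed

lemma adj_sym:
  assumes "k \<ge> 1"
  shows "adj k u v \<longleftrightarrow> adj k v u"
proof -
  interpret pair_graph "andrasfai k" using pair_graph_andrasfai[OF assms] .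
  show ?thesis using pair_sym_arcs by (auto simp: symmetric_def sym_def)
qed

lemma complement_arc_iff:
  assumes "k \<ge> 1"
  shows "(u, v) \<in> parcs (complement_graph (andrasfai k)) \<longleftrightarrow>
    u \<in> {0..<3 * int k - 1} \<and> v \<in> {0..<3 * int k - 1} \<and> u \<noteq> v \<and> \<not> adj k u v"
  using assms by (auto simp: complement_graph_def pverts_andrasfai)

text \<open>
  The connection set of the complement contains \<open>\<plusminus>2\<close>, \<open>\<plusminus>3\<close>, and every positive residue that is 2
  modulo 3. A difference \<open>s \<ge> 4\<close> with \<open>s mod 3 = 1\<close> is the sum of \<open>2\<close> and \<open>s - 2\<close>. The
  difference 1 is the sum of \<open>3\<close> and \<open>-2\<close>, taken in the order that keeps the midpoint \<open>v - 2\<close> or \<open>v + 3\<close> within the range.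
\<close>

lemma complement_two_step:
  assumes k: "k \<ge> 2" and V: "u \<in> {0..<3 * int k - 1}" "v \<in> {0..<3 * int k - 1}"
    and a: "adj k u v"
  shows "\<exists>w. (u, w) \<in> parcs (complement_graph (andrasfai k)) \<and>
    (w, v) \<in> parcs (complement_graph (andrasfai k))"
proof -
  have k1: "k \<ge> 1" using k by simp
  have *: "\<exists>w. w \<in> {0..<3 * int k - 1} \<and> w \<noteq> u \<and> w \<noteq> v \<and> \<not> adj k u w \<and> \<not> adj k v w"
    if V: "u \<in> {0..<3 * int k - 1}" "v \<in> {0..<3 * int k - 1}" and lt: "v < u" and a: "adj k u v"
    for u v
  proof -
    have m: "(u - v) mod 3 = 1" using a lt V by (simp add: adj_iff[OF k1])
    then have "u - v \<ge> 4 \<or> u - v = 1" using lt by presburger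
    then consider "u - v \<ge> 4" | "u - v = 1" "v \<ge> 2" | "u - v = 1" "v < 2" by linarith
    then show ?thesis
    proof cases
      case 1
      then have "v + 2 \<in> {0..<3 * int k - 1}" "\<not> adj k u (v + 2)" "\<not> adj k v (v + 2)"
        using V m by (auto simp: adj_iff[OF k1]) presburger+
      with 1 show ?thesis by (intro exI[of _ "v + 2"]) auto
    next
      case 2
      then have "u = v + 1" by simp
      with 2 have "v - 2 \<in> {0..<3 * int k - 1}" "\<not> adj k u (v - 2)" "\<not> adj k v (v - 2)"
        using V by (auto simp: adj_iff[OF k1])
      with 2 show ?thesis by (intro exI[of _ "v - 2"]) auto
    next
      case 3
      then have "u = v + 1" by simp
      with 3 have "v + 3 \<in> {0..<3 * int k - 1}" "\<not> adj k u (v + 3)" "\<not> adj k v (v + 3)"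
        using V k by (auto simp: adj_iff[OF k1])
      with 3 show ?thesis by (intro exI[of _ "v + 3"]) auto
    qed
  qed
  have "u \<noteq> v" using a V by (auto simp: adj_iff[OF k1])
  then show ?thesis
    using *[OF V(1,2)] *[OF V(2,1)] a V adj_sym[OF k1] complement_arc_iff[OF k1]
    by (metis linorder_neqE)
qed

lemma resolving_complement_andrasfai_iff:
  assumes k: "k \<ge> 2"
  shows "resolving_set (complement_graph (andrasfai k)) W \<longleftrightarrow> W \<subseteq> {0..<3 * int k - 1} \<and>
    (\<forall>u \<in> {0..<3 * int k - 1} - W. \<forall>v \<in> {0..<3 * int k - 1} - W. u \<noteq> v \<longrightarrow>
      (\<exists>t \<in> W. adj k u t \<longleftrightarrow> \<not> adj k v t))"
proof -
  let ?V = "{0..<3 * int k - 1}"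
  have k1: "k \<ge> 1" using k by simp
  interpret pair_graph "complement_graph (andrasfai k)"
    using pair_graph_complement[OF pair_graph_andrasfai[OF k1]] .
  have V: "pverts (complement_graph (andrasfai k)) = ?V"
    using pverts_andrasfai[OF k1] by (simp add: complement_graph_def)
  have arc: "(u, t) \<in> parcs (complement_graph (andrasfai k)) \<longleftrightarrow> \<not> adj k u t"
    if "W \<subseteq> ?V" "u \<in> ?V - W" "t \<in> W" for u t
    using that by (auto simp: complement_arc_iff[OF k1])
  have "resolving_set (complement_graph (andrasfai k)) W \<longleftrightarrow> W \<subseteq> ?V \<and>
    (\<forall>u \<in> ?V - W. \<forall>v \<in> ?V - W. u \<noteq> v \<longrightarrow>
      (\<exists>t \<in> W. (u, t) \<in> parcs (complement_graph (andrasfai k)) \<longleftrightarrow>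
               (v, t) \<notin> parcs (complement_graph (andrasfai k))))"
    unfolding V[symmetric]
    by (rule resolving_set_diameter_two)
      (use complement_two_step[OF k] complement_arc_iff[OF k1] V in auto)
  also have "\<dots> \<longleftrightarrow> W \<subseteq> ?V \<and>
    (\<forall>u \<in> ?V - W. \<forall>v \<in> ?V - W. u \<noteq> v \<longrightarrow> (\<exists>t \<in> W. adj k u t \<longleftrightarrow> \<not> adj k v t))"
    by (intro conj_cong refl ball_cong imp_cong bex_cong) (simp only: arc, blast)
  finally show ?thesis .
qed

section \<open>A resolving set of size \<open>k\<close>\<close>

lemma multiples_of_three_resolving:
  assumes k: "k \<ge> 2"
  shows "resolving_set (complement_graph (andrasfai k)) ((\<lambda>i. 3 * int i) ` {..<k})"
proof -
  let ?V = "{0..<3 * int k - 1}" and ?W = "(\<lambda>i. 3 * int i) ` {..<k}"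
  have k1: "k \<ge> 1" using k by simp
  have W: "t \<in> ?W \<longleftrightarrow> t \<in> ?V \<and> t mod 3 = 0" for t
  proof
    assume "t \<in> ?V \<and> t mod 3 = 0"
    then have "t = 3 * int (nat (t div 3))" "nat (t div 3) < k" by auto
    then show "t \<in> ?W" by blast
  qed auto
  have one: "adj k x t \<longleftrightarrow> t < x" if "x \<in> ?V" "x mod 3 = 1" "t \<in> ?W" for x t
    using that unfolding W by (simp add: adj_iff[OF k1]) presburger
  have two: "adj k x t \<longleftrightarrow> x < t" if "x \<in> ?V" "x mod 3 = 2" "t \<in> ?W" for x t
    using that unfolding W by (simp add: adj_iff[OF k1]) presburger
  have sep: "\<exists>t \<in> ?W. adj k u t \<longleftrightarrow> \<not> adj k v t"
    if uv: "u \<in> ?V - ?W" "v \<in> ?V - ?W" "u < v" for u v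
  proof -
    have V: "u \<in> ?V" "v \<in> ?V" using uv by auto
    have "u mod 3 \<noteq> 0 \<and> v mod 3 \<noteq> 0" using uv(1,2) V by (metis DiffD2 W)
    then have r: "u mod 3 = 1 \<or> u mod 3 = 2" "v mod 3 = 1 \<or> v mod 3 = 2" by presburger+
    show ?thesis
    proof (cases "u mod 3 = v mod 3")
      case True
      \<comment> \<open>The first multiple of 3 above \<open>u\<close> lies between \<open>u\<close> and \<open>v\<close>.\<close>
      define t where "t = 3 * (u div 3) + 3"
      have t: "u < t" "t < v" "t mod 3 = 0" using uv(3) True r unfolding t_def by presburger+
      then have "t \<in> ?W" unfolding W using V by auto
      then show ?thesis using one[of _ t] two[of _ t] r t True V by (intro bexI[of _ t]) auto
    next
      case False
      \<comment> \<open>The vertex 0 is below all others, so its neighbours are those of residue 1.\<close>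
      have "0 \<in> ?W" unfolding W using k by auto
      moreover have "u \<noteq> 0" "v \<noteq> 0" using r by auto
      then have "0 < u" "0 < v" using V by auto
      ultimately show ?thesis using one[of _ 0] two[of _ 0] r False V
        by (intro bexI[of _ 0]) auto
    qed
  qed
  show ?thesis
    unfolding resolving_complement_andrasfai_iff[OF k]
  proof (intro conjI ballI impI)
    show "?W \<subseteq> ?V" using W by blast
    fix u v assume "u \<in> ?V - ?W" "v \<in> ?V - ?W" "u \<noteq> v"
    then show "\<exists>t \<in> ?W. adj k u t \<longleftrightarrow> \<not> adj k v t"
      using sep[of u v] sep[of v u] by (metis linorder_neqE)
  qed
qed

section \<open>Every resolving set has at least \<open>k\<close> elements\<close>

text \<open>
  This is \<open>k * x\<close> reduced modulo \<open>3 k - 1\<close>: the coordinate in which a neighbourhood becomes an arc.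
\<close>

definition arc_pos :: "nat \<Rightarrow> int \<Rightarrow> int" where
  "arc_pos k x = int k * (x mod 3) + x div 3"

lemma arc_pos_cases:
  assumes "u \<in> {0..<3 * int k - 1}"
  obtains q where "0 \<le> q" "q < int k" "u = 3 * q" "arc_pos k u = q"
  | q where "0 \<le> q" "q < int k" "u = 3 * q + 1" "arc_pos k u = int k + q"
  | q where "0 \<le> q" "q < int k - 1" "u = 3 * q + 2" "arc_pos k u = 2 * int k + q"
proof -
  have d: "u = 3 * (u div 3) + u mod 3" "0 \<le> u mod 3" "u mod 3 < 3" by simp_all
  then consider "u mod 3 = 0" | "u mod 3 = 1" | "u mod 3 = 2" by linarith
  then show thesis
    using that[of "u div 3"] d(1) assms unfolding arc_pos_def by cases simp_all
qed

lemma arc_pos_range: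
  assumes "u \<in> {0..<3 * int k - 1}"
  shows "arc_pos k u \<in> {0..<3 * int k - 1}"
  using arc_pos_cases[OF assms] assms by cases auto

lemma adj_iff_arc_pos:
  assumes "k \<ge> 1" "u \<in> {0..<3 * int k - 1}" "v \<in> {0..<3 * int k - 1}"
  shows "adj k u v \<longleftrightarrow>
    \<bar>arc_pos k u - arc_pos k v\<bar> \<in> {int k..<2 * int k}"
proof -
  have m: "(3 * a - 3 * b) mod 3 = 0" "(3 * a - 3 * b + 1) mod 3 = 1" "(3 * a - 3 * b + 2) mod 3 = 2"
    "(1 + (3 * a - 3 * b)) mod 3 = 1"
    "(3 * a - 3 * b - 1) mod 3 = 2" "(3 * a - 3 * b - 2) mod 3 = 1"
    "(3 * a + 1 - 3 * b) mod 3 = 1" "(3 * a + 2 - 3 * b) mod 3 = 2"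
    "(3 * a - (3 * b + 1)) mod 3 = 2" "(3 * a - (3 * b + 2)) mod 3 = 1"
    "(3 * a + 1 - (3 * b + 2)) mod 3 = 2" "(3 * a + 2 - (3 * b + 1)) mod 3 = 1" for a b :: int
    by presburger+
  show ?thesis
    unfolding adj_iff[OF assms]
    by (rule arc_pos_cases[OF assms(2)]; rule arc_pos_cases[OF assms(3)]) (auto simp: m)
qed

text \<open>
  The arc of neighbours of \<open>t\<close>, cut open at \<open>0\<close>, is an interval or the complement of one. The two
  thresholds are its ends; the middle one of the three cases is the one where the arc runs across
  the cut.
\<close>

lemma adjacency_thresholds:
  assumes k: "k \<ge> 1" and t: "t \<in> {0..<3 * int k - 1}"
  shows "\<exists>a b. \<forall>u \<in> {0..<3 * int k - 1}. \<forall>v \<in> {0..<3 * int k - 1}.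
    (a \<le> arc_pos k u \<longleftrightarrow> a \<le> arc_pos k v) \<and> (b \<le> arc_pos k u \<longleftrightarrow> b \<le> arc_pos k v) \<longrightarrow>
    (adj k u t \<longleftrightarrow> adj k v t)"
proof -
  let ?V = "{0..<3 * int k - 1}" and ?p = "arc_pos k t"
  have p: "?p \<in> ?V" using arc_pos_range[OF t] .
  consider "?p < int k" | "int k \<le> ?p" "?p < 2 * int k - 1" | "2 * int k - 1 \<le> ?p" by linarith
  then show ?thesis
  proof cases
    case 1
    have "adj k u t \<longleftrightarrow> ?p + int k \<le> arc_pos k u \<and> \<not> ?p + 2 * int k \<le> arc_pos k u"
      if "u \<in> ?V" for u
      using 1 p arc_pos_range[OF that] by (auto simp: adj_iff_arc_pos[OF k that t])
    then show ?thesis by blast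
  next
    case 2
    have "adj k u t \<longleftrightarrow> \<not> ?p - int k + 1 \<le> arc_pos k u \<or> ?p + int k \<le> arc_pos k u"
      if "u \<in> ?V" for u
      using 2 p arc_pos_range[OF that] by (auto simp: adj_iff_arc_pos[OF k that t])
    then show ?thesis by blast
  next
    case 3
    have "adj k u t \<longleftrightarrow> ?p - 2 * int k + 1 \<le> arc_pos k u \<and> \<not> ?p - int k + 1 \<le> arc_pos k u"
      if "u \<in> ?V" for u
      using 3 p arc_pos_range[OF that] by (auto simp: adj_iff_arc_pos[OF k that t])
    then show ?thesis by blast
  qed
qed

text \<open>
  The points of \<open>U\<close> are told apart by how many thresholds they have passed.
\<close>

lemma card_le_Suc_thresholds:
  fixes f :: "'a \<Rightarrow> 'b :: linorder"
  assumes P: "finite P"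
    and sep: "\<And>u v. u \<in> U \<Longrightarrow> v \<in> U \<Longrightarrow> u \<noteq> v \<Longrightarrow> \<exists>p \<in> P. p \<le> f u \<longleftrightarrow> \<not> p \<le> f v"
  shows "card U \<le> card P + 1"
proof -
  define c where "c u = card {p \<in> P. p \<le> f u}" for u
  have less: "c u < c v" if "p \<in> P" "\<not> p \<le> f u" "p \<le> f v" for u v p
    unfolding c_def
  proof (rule psubset_card_mono)
    have "{p \<in> P. p \<le> f u} \<subseteq> {p \<in> P. p \<le> f v}" using that by auto
    moreover have "p \<in> {p \<in> P. p \<le> f v} - {p \<in> P. p \<le> f u}" using that by simp
    ultimately show "{p \<in> P. p \<le> f u} \<subset> {p \<in> P. p \<le> f v}" by blast
  qed (use P in simp)
  have "inj_on c U"
    by (rule inj_onI) (metis less nless_le sep)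
  moreover have "c ` U \<subseteq> {..card P}"
    using P by (auto simp: c_def intro: card_mono)
  ultimately have "card U \<le> card {..card P}" by (intro card_inj_on_le) auto
  then show ?thesis by simp
qed

lemma resolving_set_card_ge:
  assumes k: "k \<ge> 2" and W: "resolving_set (complement_graph (andrasfai k)) W"
  shows "k \<le> card W"
proof -
  let ?V = "{0..<3 * int k - 1}"
  have k1: "k \<ge> 1" using k by simp
  have WV: "W \<subseteq> ?V" and sep: "\<And>u v. u \<in> ?V - W \<Longrightarrow> v \<in> ?V - W \<Longrightarrow> u \<noteq> v \<Longrightarrow>
      \<exists>t \<in> W. adj k u t \<longleftrightarrow> \<not> adj k v t"
    using W unfolding resolving_complement_andrasfai_iff[OF k] by blast+
  have fin: "finite W" using WV finite_subset by blast
  have "\<forall>t \<in> ?V. \<exists>a b. \<forall>u \<in> ?V. \<forall>v \<in> ?V.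
    (a \<le> arc_pos k u \<longleftrightarrow> a \<le> arc_pos k v) \<and> (b \<le> arc_pos k u \<longleftrightarrow> b \<le> arc_pos k v) \<longrightarrow>
    (adj k u t \<longleftrightarrow> adj k v t)"
    using adjacency_thresholds[OF k1] by blast
  then obtain a b where ab: "\<And>t u v. t \<in> ?V \<Longrightarrow> u \<in> ?V \<Longrightarrow> v \<in> ?V \<Longrightarrow>
    (a t \<le> arc_pos k u \<longleftrightarrow> a t \<le> arc_pos k v) \<Longrightarrow> (b t \<le> arc_pos k u \<longleftrightarrow> b t \<le> arc_pos k v) \<Longrightarrow>
    adj k u t \<longleftrightarrow> adj k v t"
    unfolding bchoice_iff by blast
  define P where "P = a ` W \<union> b ` W"
  have "\<exists>p \<in> P. p \<le> arc_pos k u \<longleftrightarrow> \<not> p \<le> arc_pos k v"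
    if uv: "u \<in> ?V - W" "v \<in> ?V - W" "u \<noteq> v" for u v
  proof -
    obtain t where t: "t \<in> W" "adj k u t \<longleftrightarrow> \<not> adj k v t" using sep[OF uv] by blast
    then have "\<not> ((a t \<le> arc_pos k u \<longleftrightarrow> a t \<le> arc_pos k v) \<and>
        (b t \<le> arc_pos k u \<longleftrightarrow> b t \<le> arc_pos k v))"
      using ab[of t u v] uv WV by blast
    then show ?thesis using t(1) unfolding P_def by blast
  qed
  then have "card (?V - W) \<le> card P + 1"
    using fin by (intro card_le_Suc_thresholds[of P _ "arc_pos k"]) (auto simp: P_def)
  moreover have "card P \<le> card W + card W"
    unfolding P_def using card_Un_le[of "a ` W" "b ` W"] card_image_le[OF fin, of a]
      card_image_le[OF fin, of b] by linarith
  moreover have "card (?V - W) = 3 * k - 1 - card W"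
    using WV fin by (simp add: card_Diff_subset nat_diff_distrib nat_mult_distrib)
  ultimately show ?thesis using k by linarith
qed

theorem theorem2p2:
  fixes k :: nat
  assumes "k \<ge> 2"
  shows "metric_dim (complement_graph (andrasfai k)) = k"
  unfolding metric_dim_def
proof (rule Least_equality)
  have "card ((\<lambda>i. 3 * int i) ` {..<k}) = k" by (simp add: card_image inj_on_def)
  then show "\<exists>W. resolving_set (complement_graph (andrasfai k)) W \<and> card W = k"
    using multiples_of_three_resolving[OF assms] by blast
next
  fix m assume "\<exists>W. resolving_set (complement_graph (andrasfai k)) W \<and> card W = m"
  then show "k \<le> m" using resolving_set_card_ge[OF assms] by blast
qed

end
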